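(* For every set $\Phi\cup\{\psi\}\subseteq\mathcal L_!$ of standard formulas, $\Phi\models_{\mathsf{InqI}}\psi$ if and only if $\Phi\models_{\mathsf{IPL}}\psi$.
   Context: Fix a set $\mathcal P$ of atomic sentences. The language $\mathcal L$ is given by $\varphi::=p\mid\bot\mid\varphi\land\varphi\mid\varphi\lor\varphi\mid\varphi\to\varphi\mid\varphi\sqcup\varphi$ with $p\in\mathcal P$, where $\lor$ is standard disjunction and $\sqcup$ denotes inquisitive disjunction. Standard formulas are those with no occurrence of $\sqcup$; their set is $\mathcal L_!$. An intuitionistic Kripke model is $M=\langle W,R,V\rangle$ with $W$ a set (of worlds), $R$ a partial order on $W$, and $V:W\times\mathcal P\to\{0,1\}$ such that $wRw'$ and $V(w,p)=1$ imply $V(w',p)=1$. A team is a set $t\subseteq W$; $R[w]=\{w'\mid wRw'\}$ and $R[t]=\bigcup_{w\in t}R[w]$. Support $M,t\models\varphi$ is defined by: - $M,t\models p$ iff $V(w,p)=1$ for all $w\in t$; - $M,t\models\bot$ iff $t=\emptyset$; - $M,t\models\varphi\land\psi$ iff $M,t\models\varphi$ and $M,t\models\psi$; - $M,t\models\varphi\lor\psi$ iff there are $t',t''$ with $t=t'\cup t''$, $M,t'\models\varphi$ and $M,t''\models\psi$; - $M,t\models\varphi\to\psi$ iff for all $t'\subseteq R[t]$, $M,t'\models\varphi$ implies $M,t'\models\psi$; - $M,t\models\varphi\sqcup\psi$ iff $M,t\models\varphi$ or $M,t\models\psi$. $\Phi\models_{\mathsf{InqI}}\psi$ means: for every intuitionistic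 Kripke model $M$ and team $t$ in $M$, if $M,t\models\varphi$ for all $\varphi\in\Phi$ then $M,t\models\psi$. $\models_{\mathsf{IPL}}$ is the consequence relation of intuitionistic propositional logic in the connectives $\bot,\land,\lor,\to$ (equivalently, preservation of truth at worlds of intuitionistic Kripke models under the usual Kripke clauses). *)

theory Defs
  imports Main
begin

text \<open>The set of atomic sentences is the type variable \<open>'p\<close>.\<close>

datatype 'p form =
    Atom 'p
  | Falsum  (\<open>\<^bold>\<bottom>\<close>)
  | Conj "'p form" "'p form"  (infixr \<open>\<^bold>\<and>\<close> 65)
  | Disj "'p form" "'p form"  (infixr \<open>\<^bold>\<or>\<close> 60)
  | Impl "'p form" "'p form"  (infixr \<open>\<^bold>\<rightarrow>\<close> 55)
  | InqDisj "'p form" "'p form"  (infixr \<open>\<^bold>\<squnion>\<close> 60)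

primrec standard :: "'p form \<Rightarrow> bool" where
  "standard (Atom p) \<longleftrightarrow> True"
| "standard \<^bold>\<bottom> \<longleftrightarrow> True"
| "standard (\<phi> \<^bold>\<and> \<psi>) \<longleftrightarrow> standard \<phi> \<and> standard \<psi>"
| "standard (\<phi> \<^bold>\<or> \<psi>) \<longleftrightarrow> standard \<phi> \<and> standard \<psi>"
| "standard (\<phi> \<^bold>\<rightarrow> \<psi>) \<longleftrightarrow> standard \<phi> \<and> standard \<psi>"
| "standard (\<phi> \<^bold>\<squnion> \<psi>) \<longleftrightarrow> False"

text \<open>Models have an explicit carrier, so that \<open>'w\<close> is only an ambient universe of worlds.
  Only the values of the valuation on the carrier matter.\<close>

record ('w, 'p) model =
  worlds :: "'w set"
  acc :: "('w \<times> 'w) set"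
  val :: "'w \<Rightarrow> 'p \<Rightarrow> bool"

definition kripke_model :: "('w, 'p) model \<Rightarrow> bool" where
  "kripke_model M \<longleftrightarrow>
     partial_order_on (worlds M) (acc M) \<and>
     (\<forall>w w' p. (w, w') \<in> acc M \<longrightarrow> val M w p \<longrightarrow> val M w' p)"

text \<open>\<open>acc M `` t\<close> is the up-set $R[t]$.\<close>

primrec support :: "('w, 'p) model \<Rightarrow> 'w set \<Rightarrow> 'p form \<Rightarrow> bool" where
  "support M t (Atom p) \<longleftrightarrow> (\<forall>w\<in>t. val M w p)"
| "support M t \<^bold>\<bottom> \<longleftrightarrow> t = {}"
| "support M t (\<phi> \<^bold>\<and> \<psi>) \<longleftrightarrow> support M t \<phi> \<and> support M t \<psi>"
| "support M t (\<phi> \<^bold>\<or> \<psi>) \<longleftrightarrow> (\<exists>t' t''. t = t' \<union> t'' \<and> support M t' \<phi> \<and> support M t'' \<psi>)"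
| "support M t (\<phi> \<^bold>\<rightarrow> \<psi>) \<longleftrightarrow> (\<forall>t'. t' \<subseteq> acc M `` t \<longrightarrow> support M t' \<phi> \<longrightarrow> support M t' \<psi>)"
| "support M t (\<phi> \<^bold>\<squnion> \<psi>) \<longleftrightarrow> support M t \<phi> \<or> support M t \<psi>"

text \<open>Truth at a world by the usual Kripke clauses. There is deliberately no clause for
  \<open>\<^bold>\<squnion>\<close>, which is not a connective of intuitionistic logic.\<close>

primrec (nonexhaustive) forces :: "('w, 'p) model \<Rightarrow> 'w \<Rightarrow> 'p form \<Rightarrow> bool" where
  "forces M w (Atom p) \<longleftrightarrow> val M w p"
| "forces M w \<^bold>\<bottom> \<longleftrightarrow> False"
| "forces M w (\<phi> \<^bold>\<and> \<psi>) \<longleftrightarrow> forces M w \<phi> \<and> forces M w \<psi>"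
| "forces M w (\<phi> \<^bold>\<or> \<psi>) \<longleftrightarrow> forces M w \<phi> \<or> forces M w \<psi>"
| "forces M w (\<phi> \<^bold>\<rightarrow> \<psi>) \<longleftrightarrow> (\<forall>w'. (w, w') \<in> acc M \<longrightarrow> forces M w' \<phi> \<longrightarrow> forces M w' \<psi>)"

text \<open>HOL cannot quantify over all types inside a formula, so both consequence relations
  carry the universe \<open>'w\<close> from which worlds are drawn as a parameter. A statement that is
  polymorphic in \<open>'w\<close> covers models of every size.\<close>

definition entails_InqI :: "'w itself \<Rightarrow> 'p form set \<Rightarrow> 'p form \<Rightarrow> bool" where
  "entails_InqI (_ :: 'w itself) \<Phi> \<psi> \<longleftrightarrow>
     (\<forall>(M :: ('w, 'p) model) t. kripke_model M \<longrightarrow> t \<subseteq> worlds M \<longrightarrow>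
        (\<forall>\<phi>\<in>\<Phi>. support M t \<phi>) \<longrightarrow> support M t \<psi>)"

definition entails_IPL :: "'w itself \<Rightarrow> 'p form set \<Rightarrow> 'p form \<Rightarrow> bool" where
  "entails_IPL (_ :: 'w itself) \<Phi> \<psi> \<longleftrightarrow>
     (\<forall>(M :: ('w, 'p) model) w. kripke_model M \<longrightarrow> w \<in> worlds M \<longrightarrow>
        (\<forall>\<phi>\<in>\<Phi>. forces M w \<phi>) \<longrightarrow> forces M w \<psi>)"

text \<open>For standard formulas no universe is larger than \<open>'p form set\<close> as far as
  intuitionistic consequence is concerned: identifying worlds with their theories turns any
  model into one over \<open>'p form set\<close>. Hence \<open>entails_IPL TYPE('p form set)\<close> is consequence
  over all intuitionistic Kripke models.\<close>

lemma forces_mono: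
  assumes M: "kripke_model M" and "standard \<phi>" and "(w, w') \<in> acc M" and "forces M w \<phi>"
  shows "forces M w' \<phi>"
  using assms(2-)
proof (induction \<phi> arbitrary: w w')
  case (Atom p)
  then show ?case using M unfolding kripke_model_def by auto
next
  case (Impl \<phi> \<psi>)
  have "trans (acc M)"
    using M by (simp add: kripke_model_def partial_order_on_def preorder_on_def)
  then show ?case using Impl.prems by (auto dest: transD)
qed auto

lemma entails_IPL_universe:
  fixes \<Phi> :: "'p form set"
  assumes std: "\<forall>\<phi> \<in> \<Phi> \<union> {\<psi>}. standard \<phi>"
    and ent: "entails_IPL TYPE('p form set) \<Phi> \<psi>"
  shows "entails_IPL TYPE('w) \<Phi> \<psi>"
  unfolding entails_IPL_def
proof (intro allI impI)
  fix M :: "('w, 'p) model" and w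
  assume M: "kripke_model M" and w: "w \<in> worlds M" and prem: "\<forall>\<phi>\<in>\<Phi>. forces M w \<phi>"
  define Th where "Th v = {\<phi>. standard \<phi> \<and> forces M v \<phi>}" for v
  define N :: "('p form set, 'p) model" where
    "N = \<lparr>worlds = Th ` worlds M,
          acc = {(A, B). A \<in> Th ` worlds M \<and> B \<in> Th ` worlds M \<and> A \<subseteq> B},
          val = (\<lambda>A p. Atom p \<in> A)\<rparr>"
  have N: "kripke_model N"
    unfolding kripke_model_def partial_order_on_def preorder_on_def refl_on_def trans_def antisym_def N_def
    by auto
  have sub: "acc M \<subseteq> worlds M \<times> worlds M"
    using M by (simp add: kripke_model_def partial_order_on_def preorder_on_def refl_on_def)
  have acc: "(Th u, Th v) \<in> acc N" if "(u, v) \<in> acc M" for u v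
    using that sub forces_mono[OF M] by (auto simp: N_def Th_def)
  have truth: "forces N (Th v) \<phi> \<longleftrightarrow> forces M v \<phi>" if "standard \<phi>" "v \<in> worlds M" for \<phi> v
    using that
  proof (induction \<phi> arbitrary: v)
    case (Atom p)
    then show ?case by (simp add: N_def Th_def)
  next
    case (Impl \<phi> \<psi>)
    show ?case
    proof
      assume L: "forces N (Th v) (\<phi> \<^bold>\<rightarrow> \<psi>)"
      show "forces M v (\<phi> \<^bold>\<rightarrow> \<psi>)"
      proof (simp only: forces.simps, intro allI impI)
        fix u assume u: "(v, u) \<in> acc M" "forces M u \<phi>"
        then have "u \<in> worlds M" using sub by auto
        then have "forces N (Th u) \<phi> \<longleftrightarrow> forces M u \<phi>" "forces N (Th u) \<psi> \<longleftrightarrow> forces M u \<psi>"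
          using Impl.IH Impl.prems by simp_all
        then show "forces M u \<psi>" using L acc[OF u(1)] u(2) by simp
      qed
    next
      assume R: "forces M v (\<phi> \<^bold>\<rightarrow> \<psi>)"
      have "forces N A \<psi>" if A: "(Th v, A) \<in> acc N" "forces N A \<phi>" for A
      proof -
        obtain u where u: "u \<in> worlds M" "A = Th u" "Th v \<subseteq> Th u"
          using A(1) by (auto simp: N_def)
        have "(\<phi> \<^bold>\<rightarrow> \<psi>) \<in> Th v"
          unfolding Th_def using R Impl.prems(1) by blast
        then have "(\<phi> \<^bold>\<rightarrow> \<psi>) \<in> Th u" using u(3) by blast
        then have "forces M u (\<phi> \<^bold>\<rightarrow> \<psi>)" by (simp add: Th_def)
        moreover have "(u, u) \<in> acc M"
          using M u(1) by (auto simp: kripke_model_def partial_order_on_def preorder_on_def refl_on_def)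
        ultimately have "forces M u \<phi> \<longrightarrow> forces M u \<psi>" by simp
        moreover have "forces N A \<phi> \<longleftrightarrow> forces M u \<phi>" "forces N A \<psi> \<longleftrightarrow> forces M u \<psi>"
          using Impl.IH Impl.prems u by simp_all
        ultimately show ?thesis using A(2) by simp
      qed
      then show "forces N (Th v) (\<phi> \<^bold>\<rightarrow> \<psi>)" by simp
    qed
  qed auto
  have "Th w \<in> worlds N" using w by (simp add: N_def)
  moreover have "\<forall>\<phi>\<in>\<Phi>. forces N (Th w) \<phi>" using prem std truth w by auto
  ultimately have "forces N (Th w) \<psi>"
    using ent N unfolding entails_IPL_def by blast
  then show "forces M w \<psi>" using truth std w by auto
qed

end

theory Submission
  imports Defs
begin

text \<open>The two semantics are compared inside one fixed model. By induction on the formula,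
  flatness reduces support at a team to forcing at its worlds; only \<or> and \<rightarrow> need an
  argument, since their clauses quantify over teams. A world refuting the intuitionistic entailment
  then gives a refuting singleton team, and a refuting team contains a refuting world. As the model
  never changes, the equivalence holds over each universe \<open>'w\<close>.\<close>

text \<open>On standard formulas support is flat: a team supports a formula iff each of its worlds
  forces it. Entailment between flat formulas is decided on singleton teams.\<close>

lemma support_iff_forces:
  assumes "standard \<phi>"
  shows "support M t \<phi> \<longleftrightarrow> (\<forall>w\<in>t. forces M w \<phi>)"
  using assms
proof (induction \<phi> arbitrary: t)
  case (Disj \<phi> \<psi>)
  then have IH: "support M s \<phi> \<longleftrightarrow> (\<forall>w\<in>s. forces M w \<phi>)"
      "support M s \<psi> \<longleftrightarrow> (\<forall>w\<in>s. forces M w \<psi>)" for s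
    by simp_all
  show ?case
  proof
    assume "support M t (\<phi> \<^bold>\<or> \<psi>)"
    then show "\<forall>w\<in>t. forces M w (\<phi> \<^bold>\<or> \<psi>)" by (auto simp: IH)
  next
    assume "\<forall>w\<in>t. forces M w (\<phi> \<^bold>\<or> \<psi>)"
    \<comment> \<open>Split the team by which disjunct a world forces; the parts may overlap, as the
      clause for \<or> allows.\<close>
    then have "t = {w\<in>t. forces M w \<phi>} \<union> {w\<in>t. forces M w \<psi>}" by auto
    moreover have "support M {w\<in>t. forces M w \<phi>} \<phi>" "support M {w\<in>t. forces M w \<psi>} \<psi>"
      by (simp_all add: IH)
    ultimately show "support M t (\<phi> \<^bold>\<or> \<psi>)" unfolding support.simps by blast
  qed
next
  case (Impl \<phi> \<psi>)
  then have IH: "support M s \<phi> \<longleftrightarrow> (\<forall>w\<in>s. forces M w \<phi>)"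
      "support M s \<psi> \<longleftrightarrow> (\<forall>w\<in>s. forces M w \<psi>)" for s
    by simp_all
  show ?case
  proof
    assume L: "support M t (\<phi> \<^bold>\<rightarrow> \<psi>)"
    have "forces M v \<psi>" if "w \<in> t" "(w, v) \<in> acc M" "forces M v \<phi>" for w v
    proof -
      \<comment> \<open>A single successor is itself a team to which the clause for \<rightarrow>
        applies.\<close>
      have "{v} \<subseteq> acc M `` t" using that by auto
      moreover have "support M {v} \<phi>" using that(3) by (simp add: IH)
      ultimately have "support M {v} \<psi>" using L unfolding support.simps by blast
      then show ?thesis by (simp add: IH)
    qed
    then show "\<forall>w\<in>t. forces M w (\<phi> \<^bold>\<rightarrow> \<psi>)" by simp
  next
    assume "\<forall>w\<in>t. forces M w (\<phi> \<^bold>\<rightarrow> \<psi>)"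
    then show "support M t (\<phi> \<^bold>\<rightarrow> \<psi>)" by (fastforce simp: IH)
  qed
qed auto

theorem theorem4p2:
  fixes \<Phi> :: "'p form set" and \<psi> :: "'p form"
  assumes "\<forall>\<phi> \<in> \<Phi> \<union> {\<psi>}. standard \<phi>"
  shows "entails_InqI TYPE('w) \<Phi> \<psi> \<longleftrightarrow> entails_IPL TYPE('w) \<Phi> \<psi>"
proof -
  have flat: "support M t \<phi> \<longleftrightarrow> (\<forall>w\<in>t. forces M w \<phi>)"
    if "\<phi> \<in> \<Phi> \<union> {\<psi>}" for M :: "('w, 'p) model" and t \<phi>
    using assms that by (intro support_iff_forces) blast
  show ?thesis
  proof
    assume L: "entails_InqI TYPE('w) \<Phi> \<psi>"
    show "entails_IPL TYPE('w) \<Phi> \<psi>"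
      unfolding entails_IPL_def
    proof (intro allI impI)
      fix M :: "('w, 'p) model" and w
      assume "kripke_model M" "w \<in> worlds M" "\<forall>\<phi>\<in>\<Phi>. forces M w \<phi>"
      then have "kripke_model M" "{w} \<subseteq> worlds M" "\<forall>\<phi>\<in>\<Phi>. support M {w} \<phi>"
        using flat by simp_all
      then have "support M {w} \<psi>"
        using L unfolding entails_InqI_def by blast
      then show "forces M w \<psi>" using flat by simp
    qed
  next
    assume R: "entails_IPL TYPE('w) \<Phi> \<psi>"
    show "entails_InqI TYPE('w) \<Phi> \<psi>"
      unfolding entails_InqI_def
    proof (intro allI impI)
      fix M :: "('w, 'p) model" and t
      assume "kripke_model M" "t \<subseteq> worlds M" "\<forall>\<phi>\<in>\<Phi>. support M t \<phi>"
      \<comment> \<open>By flatness each world of \<open>t\<close> forces all of \<Phi>, so the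
        intuitionistic entailment applies to it separately.\<close>
      then have "\<forall>w\<in>t. forces M w \<psi>"
        using R flat unfolding entails_IPL_def by blast
      then show "support M t \<psi>" using flat by simp
    qed
  qed
qed

end
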